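(* Let $A$ be a positive linear operator (not assumed densely defined or closed) in a real or complex Hilbert space $\mathcal{H}$. The following assertions are equivalent: (i) $A$ is densely defined and selfadjoint. (ii) $A$ is symmetric and $\operatorname{ran}(I+A)=\mathcal{H}$.
   Context: Linear operators in $\mathcal{H}$ are defined on linear subspaces. $A$ is positive if $(Ah\mid h)\geq 0$ for all $h\in\operatorname{dom}A$; $A$ is symmetric if $(Ah\mid h')=(h\mid Ah')$ for all $h,h'\in\operatorname{dom}A$ (no density of the domain required). Selfadjoint means densely defined with $A^*=A$ (equality including domains). *)

theory Defs
  imports "HOL-Analysis.Analysis" "HOL-Library.Complex_Order"
begin

text \<open>
  Real Hilbert spaces are the types of sort \<open>{real_inner, complete_space}\<close>.  The library has no
  complex counterpart.  A complex inner product space is presented here on top of its underlying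
  real inner product space, whose inner product is the real part of the complex one; both have the
  same norm and topology, so the existing notions of closure and completeness apply.  The complex
  inner product is linear in its first argument.
\<close>

class complex_inner = real_inner +
  fixes scaleC :: "complex \<Rightarrow> 'a \<Rightarrow> 'a"
    and cinner :: "'a \<Rightarrow> 'a \<Rightarrow> complex"
  assumes scaleC_add_right: "scaleC c (x + y) = scaleC c x + scaleC c y"
    and scaleC_add_left: "scaleC (c + d) x = scaleC c x + scaleC d x"
    and scaleC_scaleC: "scaleC c (scaleC d x) = scaleC (c * d) x"
    and scaleC_of_real: "scaleC (complex_of_real r) x = scaleR r x"
    and cinner_commute: "cinner x y = cnj (cinner y x)"
    and cinner_add_left: "cinner (x + y) z = cinner x z + cinner y z"
    and cinner_scaleC_left: "cinner (scaleC c x) y = c * cinner x y"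
    and Re_cinner: "Re (cinner x y) = inner x y"

lemma vector_space_scaleC: "vector_space (scaleC :: complex \<Rightarrow> 'a::complex_inner \<Rightarrow> 'a)"
proof
  fix x :: 'a
  show "scaleC 1 x = x"
    using scaleC_of_real [of 1 x] by simp
qed (simp_all add: scaleC_add_right scaleC_add_left scaleC_scaleC)

lemma cinner_self: "cinner x x = complex_of_real ((norm x)\<^sup>2)"
proof -
  have "Im (cinner x x) = 0"
    using arg_cong [OF cinner_commute [of x x], of Im] by simp
  then show ?thesis
    by (simp add: complex_eq_iff Re_cinner power2_norm_eq_inner)
qed

instantiation complex :: complex_inner
begin

definition scaleC_complex :: "complex \<Rightarrow> complex \<Rightarrow> complex"
  where "scaleC_complex c x = c * x"

definition cinner_complex :: "complex \<Rightarrow> complex \<Rightarrow> complex"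
  where "cinner_complex x y = x * cnj y"

instance
  by standard
    (simp_all add: scaleC_complex_def cinner_complex_def inner_complex_def algebra_simps scaleR_conv_of_real)

end

text \<open>
  An operator is given by its domain \<open>D\<close> and a function \<open>A\<close>, whose values outside \<open>D\<close> are
  irrelevant.  The scalar multiplication \<open>s\<close> and the inner product \<open>ip\<close> are parameters, so that
  the same definitions serve real (\<open>scaleR\<close>, \<open>inner\<close>) and complex (\<open>scaleC\<close>, \<open>cinner\<close>) spaces.
\<close>

definition linear_operator_on ::
    "('k::comm_ring_1 \<Rightarrow> 'h::ab_group_add \<Rightarrow> 'h) \<Rightarrow> 'h set \<Rightarrow> ('h \<Rightarrow> 'h) \<Rightarrow> bool"
  where "linear_operator_on s D A \<longleftrightarrow>
    module.subspace s D \<and>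
    (\<forall>x\<in>D. \<forall>y\<in>D. A (x + y) = A x + A y) \<and>
    (\<forall>c. \<forall>x\<in>D. A (s c x) = s c (A x))"

text \<open>
  For complex-valued \<open>ip\<close>, \<open>0 \<le> z\<close> means that \<open>z\<close> is real and nonnegative.
\<close>

definition positive_on :: "('h \<Rightarrow> 'h \<Rightarrow> 'k::{zero, ord}) \<Rightarrow> 'h set \<Rightarrow> ('h \<Rightarrow> 'h) \<Rightarrow> bool"
  where "positive_on ip D A \<longleftrightarrow> (\<forall>h\<in>D. 0 \<le> ip (A h) h)"

definition symmetric_on :: "('h \<Rightarrow> 'h \<Rightarrow> 'k) \<Rightarrow> 'h set \<Rightarrow> ('h \<Rightarrow> 'h) \<Rightarrow> bool"
  where "symmetric_on ip D A \<longleftrightarrow> (\<forall>h\<in>D. \<forall>h'\<in>D. ip (A h) h' = ip h (A h'))"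

definition densely_defined :: "'h::topological_space set \<Rightarrow> bool"
  where "densely_defined D \<longleftrightarrow> closure D = UNIV"

definition adjoint_dom :: "('h \<Rightarrow> 'h \<Rightarrow> 'k) \<Rightarrow> 'h set \<Rightarrow> ('h \<Rightarrow> 'h) \<Rightarrow> 'h set"
  where "adjoint_dom ip D A = {k. \<exists>z. \<forall>h\<in>D. ip (A h) k = ip h z}"

text \<open>
  The vector described is unique for \<open>k\<close> in \<open>adjoint_dom ip D A\<close> when \<open>D\<close> is dense; the adjoint is
  meaningful only in that case.
\<close>

definition adjoint_op :: "('h \<Rightarrow> 'h \<Rightarrow> 'k) \<Rightarrow> 'h set \<Rightarrow> ('h \<Rightarrow> 'h) \<Rightarrow> 'h \<Rightarrow> 'h"
  where "adjoint_op ip D A k = (THE z. \<forall>h\<in>D. ip (A h) k = ip h z)"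

definition selfadjoint_on ::
    "('h::topological_space \<Rightarrow> 'h \<Rightarrow> 'k) \<Rightarrow> 'h set \<Rightarrow> ('h \<Rightarrow> 'h) \<Rightarrow> bool"
  where "selfadjoint_on ip D A \<longleftrightarrow>
    densely_defined D \<and> adjoint_dom ip D A = D \<and> (\<forall>k\<in>D. adjoint_op ip D A k = A k)"

end

theory Submission
  imports Defs
begin

text \<open>
  A complex operator has the same adjoint, the same symmetry and the same range when \<open>B\<close> is regarded
  as a real operator for \<open>Re (cinner x y)\<close>: replacing \<open>h\<close> by \<open>\<i> h\<close> recovers the imaginary part.
  So it suffices to treat the real case.  If \<open>A\<close> is selfadjoint, then \<open>A\<close> is closed and
  \<open>\<parallel>h\<parallel> \<le> \<parallel>h + A h\<parallel>\<close> by positivity, hence \<open>ran (I + A)\<close> is closed; its orthogonal complement is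
  \<open>ker (I + A\<^sup>*) = ker (I + A) = 0\<close>.  Conversely, if \<open>k = h + A h\<close> is orthogonal to the domain, then
  \<open>0 = (k | h) \<ge> \<parallel>h\<parallel>\<^sup>2\<close>, so the domain is dense; and if \<open>A\<^sup>* k = z\<close>, then writing \<open>k + z = h + A h\<close>
  shows that \<open>k - h\<close> is orthogonal to \<open>ran (I + A)\<close>, so \<open>k = h\<close> lies in the domain.
\<close>

section \<open>Density of subspaces via orthogonality\<close>

text \<open>The parallelogram law: midpoints of the sequence stay in \<open>S\<close>, so they
  cannot be closer to \<open>x\<close> than \<open>infdist x S\<close>, which forces late terms
  together.\<close>

lemma subspace_minimizing_sequence_Cauchy:
  fixes S :: "'a::real_inner set"
  assumes S: "subspace S" and y: "\<And>n. y n \<in> S"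
    and lim: "(\<lambda>n. dist x (y n)) \<longlonglongrightarrow> infdist x S"
  shows "Cauchy y"
proof (rule metric_CauchyI)
  fix e :: real
  assume e: "e > 0"
  define d where "d = infdist x S"
  have "(\<lambda>n. (dist x (y n))\<^sup>2) \<longlonglongrightarrow> d\<^sup>2"
    using lim unfolding d_def by (intro tendsto_intros)
  \<comment> \<open>The slack \<open>e\<^sup>2 / 4\<close> enters with total weight 4 in the
    parallelogram identity below, leaving exactly \<open>e\<^sup>2\<close>.\<close>
  then have "eventually (\<lambda>n. (dist x (y n))\<^sup>2 < d\<^sup>2 + e\<^sup>2 / 4) sequentially"
    using e by (intro order_tendstoD) auto
  then obtain N where N: "\<And>n. n \<ge> N \<Longrightarrow> (dist x (y n))\<^sup>2 < d\<^sup>2 + e\<^sup>2 / 4"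
    by (auto simp: eventually_sequentially)
  have "dist (y m) (y n) < e" if "m \<ge> N" "n \<ge> N" for m n
  proof -
    have "(1/2) *\<^sub>R (y m + y n) \<in> S"
      using S y by (intro subspace_scale subspace_add)
    then have "d \<le> norm (x - (1/2) *\<^sub>R (y m + y n))"
      unfolding d_def using infdist_le dist_norm by metis
    then have "d\<^sup>2 \<le> (norm (x - (1/2) *\<^sub>R (y m + y n)))\<^sup>2"
      by (intro power_mono) (auto simp: d_def infdist_nonneg)
    moreover have "(norm (y m - y n))\<^sup>2 =
        2 * (norm (x - y m))\<^sup>2 + 2 * (norm (x - y n))\<^sup>2 - 4 * (norm (x - (1/2) *\<^sub>R (y m + y n)))\<^sup>2"
      by (simp add: power2_norm_eq_inner algebra_simps inner_commute)
    ultimately have "(norm (y m - y n))\<^sup>2 < e\<^sup>2"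
      using N[OF that(1)] N[OF that(2)] by (simp add: dist_norm)
    then show ?thesis
      using e by (simp add: dist_norm power2_less_imp_less)
  qed
  then show "\<exists>M. \<forall>m\<ge>M. \<forall>n\<ge>M. dist (y m) (y n) < e"
    by blast
qed

text \<open>Orthogonal projection onto \<open>closure S\<close>: a minimizing sequence in
  \<open>S\<close> converges to some \<open>l\<close>, and \<open>x - l\<close> is orthogonal to
  \<open>S\<close>, hence zero.\<close>

lemma subspace_dense_if_orthogonal_trivial:
  fixes S :: "'a::{real_inner, complete_space} set"
  assumes S: "subspace S" and orth: "\<And>k. (\<And>h. h \<in> S \<Longrightarrow> inner h k = 0) \<Longrightarrow> k = 0"
  shows "closure S = UNIV"
proof -
  have "x \<in> closure S" for x
  proof -
    have ne: "S \<noteq> {}"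
      using S subspace_0 by blast
    have "\<exists>y\<in>S. dist x y < infdist x S + 1 / real (Suc n)" for n
      using ne cINF_less_iff[of S "dist x" "infdist x S + 1 / real (Suc n)"] by (simp add: infdist_notempty)
    then obtain y where yS: "\<And>n. y n \<in> S"
      and y: "\<And>n. dist x (y n) < infdist x S + 1 / real (Suc n)"
      by metis
    have lim: "(\<lambda>n. dist x (y n)) \<longlonglongrightarrow> infdist x S"
    proof (rule tendsto_sandwich[OF _ _ tendsto_const])
      show "\<forall>\<^sub>F n in sequentially. infdist x S \<le> dist x (y n)"
        using yS by (simp add: infdist_le)
      show "\<forall>\<^sub>F n in sequentially. dist x (y n) \<le> infdist x S + 1 / real (Suc n)"
        using y by (intro always_eventually allI less_imp_le)
      show "(\<lambda>n. infdist x S + 1 / real (Suc n)) \<longlonglongrightarrow> infdist x S"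
        using tendsto_add[OF tendsto_const LIMSEQ_inverse_real_of_nat]
        by (simp add: inverse_eq_divide)
    qed
    obtain l where l: "y \<longlonglongrightarrow> l"
      using subspace_minimizing_sequence_Cauchy[OF S yS lim] Cauchy_convergent convergent_def by blast
    have "(\<lambda>n. dist x (y n)) \<longlonglongrightarrow> dist x l"
      using l by (intro tendsto_intros)
    then have dl: "dist x l = infdist x S"
      using lim LIMSEQ_unique by blast
    \<comment> \<open>Otherwise a small step from \<open>l\<close> along \<open>h\<close> gets
      closer to \<open>x\<close>. Since \<open>l\<close> is only known as a limit of points of
      \<open>S\<close>, minimality is applied to \<open>y n + u *\<^sub>R h\<close> and passed to
      the limit.\<close>
    have "inner h (x - l) \<le> 0" if h: "h \<in> S" for h
    proof (rule ccontr)
      assume "\<not> inner h (x - l) \<le> 0"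
      then obtain u where u: "u > 0" "norm (u *\<^sub>R h - (x - l)) < norm (x - l)"
        using closer_points_lemma[of "x - l" h] by (auto simp: inner_commute)
      have "(\<lambda>n. dist x (y n + u *\<^sub>R h)) \<longlonglongrightarrow> dist x (l + u *\<^sub>R h)"
        using l by (intro tendsto_intros)
      moreover have "infdist x S \<le> dist x (y n + u *\<^sub>R h)" for n
        using S yS h by (intro infdist_le subspace_add subspace_scale)
      ultimately have "infdist x S \<le> dist x (l + u *\<^sub>R h)"
        by (intro LIMSEQ_le_const) auto
      moreover have "dist x (l + u *\<^sub>R h) = norm (u *\<^sub>R h - (x - l))"
        by (subst dist_commute) (simp add: dist_norm algebra_simps)
      ultimately show False
        using u dl by (simp add: dist_norm)
    qed
    note le = this
    have "inner h (x - l) = 0" if h: "h \<in> S" for h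
      using le[OF h] le[OF subspace_neg[OF S h]] by simp
    then have "x - l = 0"
      by (rule orth)
    then show ?thesis
      using l yS by (auto simp: closure_sequential)
  qed
  then show ?thesis
    by blast
qed

section \<open>Adjoints for the real inner product\<close>

lemma dense_inner_eqD:
  fixes D :: "'a::real_inner set"
  assumes D: "densely_defined D" and eq: "\<And>h. h \<in> D \<Longrightarrow> inner h x = inner h y"
  shows "x = y"
proof -
  have "closed {h. inner h (x - y) = 0}"
    by (intro closed_Collect_eq continuous_intros)
  then have "closure D \<subseteq> {h. inner h (x - y) = 0}"
    using eq by (intro closure_minimal) (auto simp: inner_diff_right)
  then have "inner (x - y) (x - y) = 0"
    using D unfolding densely_defined_def by blast
  then show ?thesis
    by simp
qed

lemma adjoint_op_eqI:
  fixes D :: "'a::real_inner set"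
  assumes D: "densely_defined D" and z: "\<And>h. h \<in> D \<Longrightarrow> inner (A h) k = inner h z"
  shows "adjoint_op inner D A k = z"
  unfolding adjoint_op_def
proof (rule the_equality)
  fix w
  assume "\<forall>h\<in>D. inner (A h) k = inner h w"
  then show "w = z"
    using z by (intro dense_inner_eqD[OF D]) simp
qed (simp add: z)

lemma selfadjoint_on_symmetric:
  fixes D :: "'a::real_inner set"
  assumes sa: "selfadjoint_on inner D A"
  shows "symmetric_on inner D A"
  unfolding symmetric_on_def
proof (intro ballI)
  fix h k
  assume h: "h \<in> D" and k: "k \<in> D"
  then have "k \<in> adjoint_dom inner D A"
    using sa by (simp add: selfadjoint_on_def)
  then obtain z where z: "\<And>g. g \<in> D \<Longrightarrow> inner (A g) k = inner g z"
    by (auto simp: adjoint_dom_def)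
  then have "adjoint_op inner D A k = z"
    using sa by (intro adjoint_op_eqI) (auto simp: selfadjoint_on_def)
  then show "inner (A h) k = inner h (A k)"
    using sa z h k by (auto simp: selfadjoint_on_def)
qed

text \<open>The inclusion of the adjoint in \<open>A\<close>, in usable form: a vector satisfying
  the adjoint relation lies in the domain, with the expected value.\<close>

lemma selfadjoint_onD:
  fixes D :: "'a::real_inner set"
  assumes sa: "selfadjoint_on inner D A" and z: "\<And>h. h \<in> D \<Longrightarrow> inner (A h) k = inner h z"
  shows "k \<in> D" and "A k = z"
proof -
  have "k \<in> adjoint_dom inner D A"
    using z by (auto simp: adjoint_dom_def)
  then show k: "k \<in> D"
    using sa by (simp add: selfadjoint_on_def)
  show "A k = z"
    using sa k adjoint_op_eqI[of D A k z, OF _ z] by (auto simp: selfadjoint_on_def)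
qed

section \<open>Linear operators and the map \<open>h + A h\<close>\<close>

lemma linear_operator_on_scaleR:
  fixes D :: "'a::real_vector set"
  shows "linear_operator_on scaleR D A \<longleftrightarrow>
    subspace D \<and> (\<forall>x\<in>D. \<forall>y\<in>D. A (x + y) = A x + A y) \<and> (\<forall>c. \<forall>x\<in>D. A (c *\<^sub>R x) = c *\<^sub>R A x)"
  by (simp add: linear_operator_on_def subspace_raw_def)

lemma linear_operator_on_diff:
  fixes D :: "'a::real_vector set"
  assumes "linear_operator_on scaleR D A" "x \<in> D" "y \<in> D"
  shows "A (x - y) = A x - A y"
proof -
  have D: "subspace D" and add: "\<And>x y. x \<in> D \<Longrightarrow> y \<in> D \<Longrightarrow> A (x + y) = A x + A y"
    and sc: "\<And>c x. x \<in> D \<Longrightarrow> A (c *\<^sub>R x) = c *\<^sub>R A x"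
    using assms by (auto simp: linear_operator_on_scaleR)
  show ?thesis
    using add[of x "- y"] sc[of y "-1"] subspace_neg[OF D] assms by simp
qed

text \<open>Pair \<open>h + A h\<close> with \<open>h\<close>, apply Cauchy-Schwarz and cancel one
  factor \<open>norm h\<close>.\<close>

lemma positive_on_norm_le:
  fixes D :: "'a::real_inner set"
  assumes "positive_on inner D A" "h \<in> D"
  shows "norm h \<le> norm (h + A h)"
proof (cases "h = 0")
  case False
  have "norm h * norm h \<le> inner (h + A h) h"
    using assms by (simp add: positive_on_def inner_add_left flip: power2_norm_eq_inner power2_eq_square)
  also have "\<dots> \<le> norm (h + A h) * norm h"
    by (rule norm_cauchy_schwarz)
  finally show ?thesis
    using False by simp
qed auto

lemma subspace_range_add_operator:
  fixes D :: "'a::real_vector set"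
  assumes "linear_operator_on scaleR D A"
  shows "subspace ((\<lambda>h. h + A h) ` D)"
proof -
  have D: "subspace D" and add: "\<And>x y. x \<in> D \<Longrightarrow> y \<in> D \<Longrightarrow> A (x + y) = A x + A y"
    and sc: "\<And>c x. x \<in> D \<Longrightarrow> A (c *\<^sub>R x) = c *\<^sub>R A x"
    using assms by (auto simp: linear_operator_on_scaleR)
  have "A 0 = 0"
    using sc[of 0 0] subspace_0[OF D] by simp
  then have "0 \<in> (\<lambda>h. h + A h) ` D"
    using subspace_0[OF D] by force
  moreover have "x + A x + (y + A y) \<in> (\<lambda>h. h + A h) ` D" if "x \<in> D" "y \<in> D" for x y
    using that add by (intro image_eqI[of _ _ "x + y"]) (auto simp: subspace_add[OF D])
  moreover have "c *\<^sub>R (x + A x) \<in> (\<lambda>h. h + A h) ` D" if "x \<in> D" for x c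
    using that sc by (intro image_eqI[of _ _ "c *\<^sub>R x"]) (auto simp: subspace_scale[OF D] scaleR_add_right)
  ultimately show ?thesis
    by (auto simp: subspace_def)
qed

section \<open>Selfadjointness implies full range\<close>

lemma closed_range_selfadjoint:
  fixes D :: "'a::{real_inner, complete_space} set"
  assumes lin: "linear_operator_on scaleR D A" and pos: "positive_on inner D A"
    and sa: "selfadjoint_on inner D A"
  shows "closed ((\<lambda>h. h + A h) ` D)"
  unfolding closed_sequential_limits
proof (intro allI impI; elim conjE)
  fix f l
  assume f: "\<forall>n. f n \<in> (\<lambda>h. h + A h) ` D" and lim: "f \<longlonglongrightarrow> l"
  then obtain y where yD: "\<And>n. y n \<in> D" and fy: "\<And>n. f n = y n + A (y n)"
    unfolding image_iff by metis
  \<comment> \<open>The norm bound for differences makes the inverse of \<open>I + A\<close>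
    nonexpansive, so preimages of a convergent sequence are Cauchy.\<close>
  have le: "dist (y m) (y n) \<le> dist (f m) (f n)" for m n
  proof -
    have "y m - y n \<in> D"
      using lin yD by (auto simp: linear_operator_on_scaleR subspace_diff)
    then show ?thesis
      using positive_on_norm_le[OF pos, of "y m - y n"] linear_operator_on_diff[OF lin yD yD, of m n]
      by (simp add: dist_norm fy algebra_simps)
  qed
  have "Cauchy y"
  proof (rule metric_CauchyI)
    fix e :: real
    assume "e > 0"
    then obtain M where "\<forall>m\<ge>M. \<forall>n\<ge>M. dist (f m) (f n) < e"
      using metric_CauchyD[OF LIMSEQ_imp_Cauchy[OF lim]] by blast
    then show "\<exists>M. \<forall>m\<ge>M. \<forall>n\<ge>M. dist (y m) (y n) < e"
      using le order_le_less_trans by blast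
  qed
  then obtain h where h: "y \<longlonglongrightarrow> h"
    using Cauchy_convergent convergent_def by blast
  have Ay: "(\<lambda>n. A (y n)) \<longlonglongrightarrow> l - h"
    using tendsto_diff[OF lim h] by (simp add: fy)
  \<comment> \<open>Closedness of \<open>A\<close> enters here: symmetry passes to the limit, so the
    adjoint sends \<open>h\<close> to \<open>l - h\<close>, and selfadjointness yields
    \<open>h \<in> D\<close> with \<open>A h = l - h\<close>.\<close>
  have "inner (A g) h = inner g (l - h)" if g: "g \<in> D" for g
  proof (rule LIMSEQ_unique)
    show "(\<lambda>n. inner (A g) (y n)) \<longlonglongrightarrow> inner (A g) h"
      using h by (intro tendsto_intros)
    have "inner (A g) (y n) = inner g (A (y n))" for n
      using selfadjoint_on_symmetric[OF sa] g yD by (auto simp: symmetric_on_def)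
    then show "(\<lambda>n. inner (A g) (y n)) \<longlonglongrightarrow> inner g (l - h)"
      using tendsto_inner[OF tendsto_const Ay] by simp
  qed
  note selfadjoint_onD[OF sa this]
  then show "l \<in> (\<lambda>h. h + A h) ` D"
    by (intro image_eqI[of _ _ h]) auto
qed

lemma range_selfadjoint:
  fixes D :: "'a::{real_inner, complete_space} set"
  assumes lin: "linear_operator_on scaleR D A" and pos: "positive_on inner D A"
    and sa: "selfadjoint_on inner D A"
  shows "(\<lambda>h. h + A h) ` D = UNIV"
proof -
  have "closure ((\<lambda>h. h + A h) ` D) = UNIV"
  proof (rule subspace_dense_if_orthogonal_trivial[OF subspace_range_add_operator[OF lin]])
    fix k
    assume k: "\<And>h. h \<in> (\<lambda>h. h + A h) ` D \<Longrightarrow> inner h k = 0"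
    \<comment> \<open>The adjoint relation with \<open>z = - k\<close>; selfadjointness then gives
      \<open>k + A k = 0\<close>, and the norm bound gives \<open>k = 0\<close>.\<close>
    have "inner (A h) k = inner h (- k)" if "h \<in> D" for h
      using k[of "h + A h"] that by (simp add: inner_add_left)
    note selfadjoint_onD[OF sa this]
    then show "k = 0"
      using positive_on_norm_le[OF pos, of k] by simp
  qed
  then show ?thesis
    using closed_range_selfadjoint[OF assms] by simp
qed

section \<open>Symmetry and full range imply selfadjointness\<close>

lemma densely_defined_of_range:
  fixes D :: "'a::{real_inner, complete_space} set"
  assumes lin: "linear_operator_on scaleR D A" and pos: "positive_on inner D A"
    and ran: "(\<lambda>h. h + A h) ` D = UNIV"
  shows "densely_defined D"
  unfolding densely_defined_def
proof (rule subspace_dense_if_orthogonal_trivial)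
  show "subspace D"
    using lin by (simp add: linear_operator_on_scaleR)
  fix k
  assume k: "\<And>h. h \<in> D \<Longrightarrow> inner h k = 0"
  obtain h where h: "h \<in> D" "k = h + A h"
    using ran by (metis UNIV_I imageE)
  then have "inner h h + inner (A h) h = 0"
    using k[of h] by (simp add: inner_add_right inner_commute)
  moreover have "0 \<le> inner (A h) h"
    using pos h by (simp add: positive_on_def)
  ultimately have "inner h h = 0"
    using inner_ge_zero[of h] by linarith
  then have "h = 0"
    by simp
  moreover have "A 0 = 0"
    using linear_operator_on_diff[OF lin h(1) h(1)] by simp
  ultimately show "k = 0"
    using h by simp
qed

lemma selfadjoint_on_of_range:
  fixes D :: "'a::{real_inner, complete_space} set"
  assumes lin: "linear_operator_on scaleR D A" and pos: "positive_on inner D A"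
    and sym: "symmetric_on inner D A" and ran: "(\<lambda>h. h + A h) ` D = UNIV"
  shows "selfadjoint_on inner D A"
proof -
  note dense = densely_defined_of_range[OF lin pos ran]
  have sym': "inner (A g) h = inner g (A h)" if "g \<in> D" "h \<in> D" for g h
    using sym that by (auto simp: symmetric_on_def)
  have "k \<in> D" if z: "\<And>h. h \<in> D \<Longrightarrow> inner (A h) k = inner h z" for k z
  proof -
    obtain h where h: "h \<in> D" "k + z = h + A h"
      using ran by (metis UNIV_I imageE)
    \<comment> \<open>Surjectivity again: with this test vector \<open>g\<close>, orthogonality of
      \<open>g + A g\<close> to \<open>k - h\<close> becomes the vanishing of \<open>k - h\<close>
      itself.\<close>
    obtain g where g: "g \<in> D" "k - h = g + A g"
      using ran by (metis UNIV_I imageE)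
    have "inner (g + A g) k = inner g (k + z)"
      using z[OF g(1)] by (simp add: inner_add_left inner_add_right)
    also have "\<dots> = inner (g + A g) h"
      using sym'[OF g(1) h(1)] by (simp add: h inner_add_left inner_add_right)
    finally have "inner (g + A g) (k - h) = 0"
      by (simp add: inner_diff_right)
    then have "inner (k - h) (k - h) = 0"
      by (simp only: g(2))
    then show ?thesis
      using h by simp
  qed
  then have "adjoint_dom inner D A \<subseteq> D"
    unfolding adjoint_dom_def by blast
  moreover have "D \<subseteq> adjoint_dom inner D A"
    using sym' unfolding adjoint_dom_def by blast
  moreover have "adjoint_op inner D A k = A k" if "k \<in> D" for k
    using that sym' by (intro adjoint_op_eqI[OF dense])
  ultimately show ?thesis
    using dense unfolding selfadjoint_on_def by blast
qed

lemma selfadjoint_on_iff_range: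
  fixes D :: "'a::{real_inner, complete_space} set"
  assumes "linear_operator_on scaleR D A" and "positive_on inner D A"
  shows "densely_defined D \<and> selfadjoint_on inner D A \<longleftrightarrow>
    symmetric_on inner D A \<and> (\<lambda>h. h + A h) ` D = UNIV"
  using range_selfadjoint[OF assms] selfadjoint_on_of_range[OF assms]
    selfadjoint_on_symmetric[of D A] densely_defined_of_range[OF assms] by auto

section \<open>Reduction of the complex case to the real case\<close>

lemma linear_operator_on_scaleC_imp_scaleR:
  fixes E :: "'b::complex_inner set"
  assumes "linear_operator_on scaleC E B"
  shows "linear_operator_on scaleR E B"
proof -
  have "module (scaleC :: complex \<Rightarrow> 'b \<Rightarrow> 'b)"
    using vector_space_scaleC by (simp add: module_iff_vector_space)
  then show ?thesis
    using assms unfolding linear_operator_on_scaleR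
    by (auto simp: linear_operator_on_def module.subspace_def subspace_def simp flip: scaleC_of_real)
qed

text \<open>Quantifying over all of \<open>E\<close> is essential to the converse: \<open>E\<close>
  is closed under multiplication by \<open>\<i>\<close>, and testing the real relation at
  \<open>scaleC \<i> h\<close> yields the imaginary parts.\<close>

lemma cinner_adjoint_iff:
  fixes E :: "'b::complex_inner set"
  assumes B: "linear_operator_on scaleC E B"
  shows "(\<forall>h\<in>E. cinner (B h) k = cinner h z) \<longleftrightarrow> (\<forall>h\<in>E. inner (B h) k = inner h z)"
proof safe
  fix h
  assume *: "\<forall>h\<in>E. inner (B h) k = inner h z" and h: "h \<in> E"
  have "module (scaleC :: complex \<Rightarrow> 'b \<Rightarrow> 'b)"
    using vector_space_scaleC by (simp add: module_iff_vector_space)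
  then have "scaleC \<i> h \<in> E" and "B (scaleC \<i> h) = scaleC \<i> (B h)"
    using B h by (auto simp: linear_operator_on_def module.subspace_def)
  then have "inner (scaleC \<i> (B h)) k = inner (scaleC \<i> h) z"
    using * by metis
  moreover have "Im (cinner x y) = - inner (scaleC \<i> x) y" for x y :: 'b
    by (simp add: cinner_scaleC_left flip: Re_cinner)
  ultimately show "cinner (B h) k = cinner h z"
    using * h by (simp add: complex_eq_iff Re_cinner)
qed (simp flip: Re_cinner)

theorem theorem7p1:
  fixes D :: "'a::{real_inner, complete_space} set" and A :: "'a \<Rightarrow> 'a"
    and E :: "'b::{complex_inner, complete_space} set" and B :: "'b \<Rightarrow> 'b"
  shows "(linear_operator_on scaleR D A \<and> positive_on inner D A \<longrightarrow>
            (densely_defined D \<and> selfadjoint_on inner D A \<longleftrightarrow>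
             symmetric_on inner D A \<and> (\<lambda>h. h + A h) ` D = UNIV)) \<and>
         (linear_operator_on scaleC E B \<and> positive_on cinner E B \<longrightarrow>
            (densely_defined E \<and> selfadjoint_on cinner E B \<longleftrightarrow>
             symmetric_on cinner E B \<and> (\<lambda>h. h + B h) ` E = UNIV))"
proof (intro conjI impI; elim conjE)
  assume B: "linear_operator_on scaleC E B" and pos: "positive_on cinner E B"
  have "positive_on inner E B"
    using pos by (auto simp: positive_on_def less_eq_complex_def Re_cinner)
  note real = selfadjoint_on_iff_range[OF linear_operator_on_scaleC_imp_scaleR[OF B] this]
  \<comment> \<open>The adjoint relations agree for every pair \<open>k\<close>, \<open>z\<close>,
    so the adjoint domains and the \<open>THE\<close> descriptions coincide.\<close>
  have "selfadjoint_on cinner E B \<longleftrightarrow> selfadjoint_on inner E B"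
    by (simp add: selfadjoint_on_def adjoint_dom_def adjoint_op_def cinner_adjoint_iff[OF B])
  \<comment> \<open>Symmetry is the adjoint relation with \<open>z = B k\<close> for each
    \<open>k\<close> in \<open>E\<close>.\<close>
  moreover have "symmetric_on cinner E B \<longleftrightarrow> symmetric_on inner E B"
    using cinner_adjoint_iff[OF B] unfolding symmetric_on_def by blast
  ultimately show "densely_defined E \<and> selfadjoint_on cinner E B \<longleftrightarrow>
      symmetric_on cinner E B \<and> (\<lambda>h. h + B h) ` E = UNIV"
    using real by simp
qed (rule selfadjoint_on_iff_range)

end
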